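(* Let $m\ge5$ be an integer, let $(W,S)$ be the Coxeter system of type $I_2(m)$ (i.e. $S=\{1,2\}$ and $W$ is the dihedral group of order $2m$), and let $R=\mathbb{Q}[q^{\pm1}]$. Then, as $R$-modules, $$H_0(X_W;R)\cong\frac{R}{(\varphi_2)},\qquad H_1(X_W;R)\cong\bigoplus_{d\mid m,\ d\ge2}\frac{R}{(\varphi_d)}.$$
   Context: $\varphi_d$ is the $d$-th cyclotomic polynomial in the variable $q$. For a Coxeter system $(W,S)$ with $S$ finite, $X_W$ is the quotient of the Salvetti complex of $W$ by the action of $W$; its fundamental group is the Artin group $G_W$, and its cells are indexed by $K_W=\{\sigma\subseteq S\mid \text{the parabolic subgroup } W_\sigma \text{ generated by }\sigma\text{ is finite}\}$ (including $\varnothing$). The coefficients are in the local system on $X_W$ given by the action of $G_W$ on $R$ in which every standard generator acts as multiplication by $-q$. Concretely, $H_*(X_W;R)$ is the homology of the complex of free $R$-modules $C_k=\bigoplus_{\sigma\in K_W,\ |\sigma|=k}R\,e_\sigma$ with boundary $$\partial(e_\sigma)=\sum_{\tau\subset\sigma,\ |\tau|=|\sigma|-1}[\sigma:\tau]\,\frac{W_\sigma(q)}{W_\tau(q)}\,e_\tau,$$ where $W_\sigma(q)=\sum_{w\in W_\sigma}q^{\ell(w)}$ is the Poincaré polynomial of $W_\sigma$ and $[\sigma:\tau]=\pm1$ is the usual simplicial incidence number with respect to a fixed total order on $S$. *)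

theory Defs
  imports
    "HOL-Algebra.Algebraic_Closure_Type"
    "HOL-Algebra.AbelCoset"
    "HOL-Algebra.Module"
    "HOL-Library.Poly_Mapping"
    "HOL-Computational_Algebra.Polynomial"
    Complex_Main
begin

hide_const (open) UnivPoly.monom UnivPoly.coeff

section \<open>Modules\<close>

text \<open>
  The record type of modules extends that of rings; its multiplicative fields play no role for
  modules and are left \<open>undefined\<close> in all the constructions below.
\<close>

definition regular_module :: "('a, 'z) ring_scheme \<Rightarrow> ('a, 'a) module"
  where "regular_module R =
    \<lparr>carrier = carrier R, monoid.mult = undefined, one = undefined,
     ring.zero = \<zero>\<^bsub>R\<^esub>, add = (\<oplus>\<^bsub>R\<^esub>), module.smult = (\<otimes>\<^bsub>R\<^esub>)\<rparr>"

definition direct_sum :: "'i set \<Rightarrow> ('i \<Rightarrow> ('a, 'b) module) \<Rightarrow> ('a, 'i \<Rightarrow> 'b) module"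
  where "direct_sum I M =
    \<lparr>carrier = {x \<in> \<Pi>\<^sub>E i\<in>I. carrier (M i). finite {i \<in> I. x i \<noteq> \<zero>\<^bsub>M i\<^esub>}},
     monoid.mult = undefined, one = undefined,
     ring.zero = (\<lambda>i\<in>I. \<zero>\<^bsub>M i\<^esub>),
     add = (\<lambda>x y. \<lambda>i\<in>I. x i \<oplus>\<^bsub>M i\<^esub> y i),
     module.smult = (\<lambda>a x. \<lambda>i\<in>I. a \<odot>\<^bsub>M i\<^esub> x i)\<rparr>"

definition quotient_module :: "('a, 'b) module \<Rightarrow> 'b set \<Rightarrow> ('a, 'b set) module"
  where "quotient_module M N =
    \<lparr>carrier = a_rcosets\<^bsub>M\<^esub> N, monoid.mult = undefined, one = undefined,
     ring.zero = N,
     add = (<+>\<^bsub>M\<^esub>),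
     module.smult = (\<lambda>a C. \<Union>x\<in>C. N +>\<^bsub>M\<^esub> (a \<odot>\<^bsub>M\<^esub> x))\<rparr>"

definition module_iso :: "('a, 'z) ring_scheme \<Rightarrow> ('a, 'b) module \<Rightarrow> ('a, 'c) module \<Rightarrow> bool"
  where "module_iso R M N \<longleftrightarrow>
    (\<exists>f. bij_betw f (carrier M) (carrier N) \<and>
      (\<forall>x\<in>carrier M. \<forall>y\<in>carrier M. f (x \<oplus>\<^bsub>M\<^esub> y) = f x \<oplus>\<^bsub>N\<^esub> f y) \<and>
      (\<forall>a\<in>carrier R. \<forall>x\<in>carrier M. f (a \<odot>\<^bsub>M\<^esub> x) = a \<odot>\<^bsub>N\<^esub> f x))"


section \<open>Laurent polynomials and cyclotomic polynomials\<close>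

text \<open>
  With the convolution product, finitely supported functions from \<open>int\<close> to \<open>rat\<close> are the group
  algebra of the integers over the rationals; \<open>Poly_Mapping.single n 1\<close> is the monomial of
  exponent \<open>n\<close>.
\<close>

type_synonym laurent = "int \<Rightarrow>\<^sub>0 rat"

abbreviation laurent_ring :: "laurent ring"
  where "laurent_ring \<equiv> ring_of_type_algebra"

definition laurent_of_poly :: "rat poly \<Rightarrow> laurent"
  where "laurent_of_poly p = (\<Sum>i\<le>Polynomial.degree p. Poly_Mapping.single (int i) (Polynomial.coeff p i))"

definition primitive_roots_of_unity :: "nat \<Rightarrow> complex set"
  where "primitive_roots_of_unity d = {z. z ^ d = 1 \<and> (\<forall>k. 0 < k \<and> k < d \<longrightarrow> z ^ k \<noteq> 1)}"

definition cyclotomic :: "nat \<Rightarrow> rat poly"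
  where "cyclotomic d =
    (THE p. map_poly of_rat p = (\<Prod>z\<in>primitive_roots_of_unity d. [:- z, 1:]))"

definition cyclotomic_quotient :: "nat \<Rightarrow> (laurent, laurent set) module"
  where "cyclotomic_quotient d =
    quotient_module (regular_module laurent_ring)
      (PIdl\<^bsub>laurent_ring\<^esub> (laurent_of_poly (cyclotomic d)))"


section \<open>Coxeter groups\<close>

text \<open>
  A Coxeter matrix on \<open>S\<close> is a function \<open>M\<close> with \<open>M s s = 1\<close> and \<open>M s t = M t s \<noteq> 1\<close> for
  \<open>s \<noteq> t\<close>, the value \<open>0\<close> standing for \<open>\<infinity>\<close> (no relation). As the relations make every generator
  an involution, the group presented by them is the monoid presented by them, that is, the
  quotient of the words over \<open>S\<close> by the congruence they generate.
\<close>

inductive coxeter_step :: "'s set \<Rightarrow> ('s \<Rightarrow> 's \<Rightarrow> nat) \<Rightarrow> 's list \<Rightarrow> 's list \<Rightarrow> bool"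
  for S :: "'s set" and M :: "'s \<Rightarrow> 's \<Rightarrow> nat"
  where "\<lbrakk>u \<in> lists S; v \<in> lists S; s \<in> S; t \<in> S; M s t \<noteq> 0\<rbrakk> \<Longrightarrow>
    coxeter_step S M (u @ concat (replicate (M s t) [s, t]) @ v) (u @ v)"

definition coxeter_rel :: "'s set \<Rightarrow> ('s \<Rightarrow> 's \<Rightarrow> nat) \<Rightarrow> ('s list \<times> 's list) set"
  where "coxeter_rel S M =
    {(u, v). u \<in> lists S \<and> v \<in> lists S \<and> equivclp (coxeter_step S M) u v}"

definition coxeter_group :: "'s set \<Rightarrow> ('s \<Rightarrow> 's \<Rightarrow> nat) \<Rightarrow> 's list set monoid"
  where "coxeter_group S M =
    \<lparr>carrier = lists S // coxeter_rel S M,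
     monoid.mult = (\<lambda>A B. coxeter_rel S M `` {u @ v |u v. u \<in> A \<and> v \<in> B}),
     one = coxeter_rel S M `` {[]}\<rparr>"

definition coxeter_gen :: "'s set \<Rightarrow> ('s \<Rightarrow> 's \<Rightarrow> nat) \<Rightarrow> 's \<Rightarrow> 's list set"
  where "coxeter_gen S M s = coxeter_rel S M `` {[s]}"

definition coxeter_length :: "'s list set \<Rightarrow> nat"
  where "coxeter_length w = (LEAST n. \<exists>u\<in>w. length u = n)"

definition parabolic :: "'s set \<Rightarrow> ('s \<Rightarrow> 's \<Rightarrow> nat) \<Rightarrow> 's set \<Rightarrow> 's list set set"
  where "parabolic S M \<sigma> = generate (coxeter_group S M) (coxeter_gen S M ` \<sigma>)"

text \<open>
  The length of an element of a parabolic subgroup is the same with respect to \<open>\<sigma>\<close> and \<open>S\<close>.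
\<close>

definition poincare_poly :: "'s set \<Rightarrow> ('s \<Rightarrow> 's \<Rightarrow> nat) \<Rightarrow> 's set \<Rightarrow> rat poly"
  where "poincare_poly S M \<sigma> = (\<Sum>w\<in>parabolic S M \<sigma>. Polynomial.monom 1 (coxeter_length w))"

text \<open>The Coxeter matrix of type \<open>I\<^sub>2(m)\<close> on a two-element set of generators.\<close>

definition I2_matrix :: "nat \<Rightarrow> 's \<Rightarrow> 's \<Rightarrow> nat"
  where "I2_matrix m s t = (if s = t then 1 else m)"


section \<open>The homology of the quotient of the Salvetti complex\<close>

definition cells :: "'s set \<Rightarrow> ('s \<Rightarrow> 's \<Rightarrow> nat) \<Rightarrow> nat \<Rightarrow> 's set set"
  where "cells S M k = {\<sigma>. \<sigma> \<subseteq> S \<and> finite (parabolic S M \<sigma>) \<and> card \<sigma> = k}"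

definition chains :: "'s set \<Rightarrow> ('s \<Rightarrow> 's \<Rightarrow> nat) \<Rightarrow> nat \<Rightarrow> (laurent, 's set \<Rightarrow> laurent) module"
  where "chains S M k = direct_sum (cells S M k) (\<lambda>_. regular_module laurent_ring)"

text \<open>
  For a facet \<open>\<tau> = \<sigma> - {s}\<close> of \<open>\<sigma>\<close> the sign is determined by the position of \<open>s\<close> in \<open>\<sigma>\<close>.
\<close>

definition incidence :: "'s::linorder set \<Rightarrow> 's set \<Rightarrow> laurent"
  where "incidence \<sigma> \<tau> = (- 1) ^ card {t \<in> \<sigma>. \<exists>s\<in>\<sigma> - \<tau>. t < s}"

text \<open>
  The division is exact: the Poincare polynomial of a parabolic subgroup divides the one of
  the group. \<open>boundary S M k\<close> maps \<open>(k + 1)\<close>-chains to \<open>k\<close>-chains.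
\<close>

definition boundary_coeff ::
    "'s::linorder set \<Rightarrow> ('s \<Rightarrow> 's \<Rightarrow> nat) \<Rightarrow> 's set \<Rightarrow> 's set \<Rightarrow> laurent"
  where "boundary_coeff S M \<sigma> \<tau> =
    incidence \<sigma> \<tau> * laurent_of_poly (poincare_poly S M \<sigma> div poincare_poly S M \<tau>)"

definition boundary ::
    "'s::linorder set \<Rightarrow> ('s \<Rightarrow> 's \<Rightarrow> nat) \<Rightarrow> nat \<Rightarrow> ('s set \<Rightarrow> laurent) \<Rightarrow> ('s set \<Rightarrow> laurent)"
  where "boundary S M k c =
    (\<lambda>\<tau>\<in>cells S M k. \<Sum>\<sigma> | \<sigma> \<in> cells S M (Suc k) \<and> \<tau> \<subset> \<sigma>. c \<sigma> * boundary_coeff S M \<sigma> \<tau>)"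

fun cycles ::
    "'s::linorder set \<Rightarrow> ('s \<Rightarrow> 's \<Rightarrow> nat) \<Rightarrow> nat \<Rightarrow> ('s set \<Rightarrow> laurent) set"
  where
    "cycles S M 0 = carrier (chains S M 0)"
  | "cycles S M (Suc k) =
      {c \<in> carrier (chains S M (Suc k)). boundary S M k c = \<zero>\<^bsub>chains S M k\<^esub>}"

definition boundaries ::
    "'s::linorder set \<Rightarrow> ('s \<Rightarrow> 's \<Rightarrow> nat) \<Rightarrow> nat \<Rightarrow> ('s set \<Rightarrow> laurent) set"
  where "boundaries S M k = boundary S M k ` carrier (chains S M (Suc k))"

definition salvetti_homology ::
    "'s::linorder set \<Rightarrow> ('s \<Rightarrow> 's \<Rightarrow> nat) \<Rightarrow> nat \<Rightarrow> (laurent, ('s set \<Rightarrow> laurent) set) module"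
  where "salvetti_homology S M k =
    quotient_module ((chains S M k)\<lparr>carrier := cycles S M k\<rparr>) (boundaries S M k)"

end

(* The Cayley graph of the dihedral group of order 2m is a cycle of length 2m, so the group elements
   are the integers mod 2m, with length the distance to 0. Hence the Poincare polynomials of the
   parabolic subgroups are 1, 1 + q and (1 + q)[m], where [m] = 1 + q + ... + q^(m-1), and the complex is
     R --(-[m], [m])--> R^2 --(1 + q, 1 + q)--> R.
   Since R is a domain, the 1-cycles are the multiples of (-1, 1), so H_1 = R/([m]). As [m] is the product
   of the pairwise coprime cyclotomic polynomials of index d >= 2 dividing m, the Chinese remainder
   theorem splits this quotient. *)

theory Submission
  imports Defs "HOL-Computational_Algebra.Computational_Algebra"
begin

section \<open>Cyclotomic polynomials\<close>

text \<open>\<open>cyclotomic\<close> is a definite description, so nothing is known of it until the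
  complex product over the primitive roots is shown to have rational coefficients; this comes by
  descent from the factorisation of q^n - 1. The Coxeter group consists of classes of words: the
  integers mod 2m are read off from the endpoint of the path that a word traces on a line. The
  relations preserve this endpoint mod 2m, and alternating words realise every endpoint. The Chinese
  remainder argument takes place in the Euclidean ring Q[q], and only its divisibilities are carried
  to R along the ring homomorphism \<open>laurent_of_poly\<close>. Quotient modules consist of
  literal cosets; one locale covers the two homology modules and the cyclotomic quotients, each a
  copy of R modulo a principal ideal. The index d = 1 is absent because [m] is q^m - 1 divided by q
  - 1.\<close>

lemma map_poly_of_rat_mult:
  "map_poly of_rat (p * q) = (map_poly of_rat p * map_poly of_rat q :: 'a :: field_char_0 poly)"
  by (rule poly_eqI) (simp add: coeff_map_poly coeff_mult of_rat_sum of_rat_mult)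

lemma map_poly_of_rat_add:
  "map_poly of_rat (p + q) = (map_poly of_rat p + map_poly of_rat q :: 'a :: field_char_0 poly)"
  by (rule poly_eqI) (simp add: coeff_map_poly of_rat_add)

lemma map_poly_of_rat_diff:
  "map_poly of_rat (p - q) = (map_poly of_rat p - map_poly of_rat q :: 'a :: field_char_0 poly)"
  by (rule poly_eqI) (simp add: coeff_map_poly of_rat_diff)

lemma map_poly_of_rat_prod:
  "map_poly of_rat (prod f A) = (\<Prod>x\<in>A. map_poly of_rat (f x) :: 'a :: field_char_0 poly)"
  by (induction A rule: infinite_finite_induct) (simp_all add: map_poly_of_rat_mult)

lemma map_poly_of_rat_inject:
  "map_poly of_rat p = (map_poly of_rat q :: 'a :: field_char_0 poly) \<longleftrightarrow> p = q"
  by (auto simp: poly_eq_iff coeff_map_poly)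

text \<open>Division with remainder is compatible with field extension: the image of
  \<open>p mod q\<close> is a multiple of the image of \<open>q\<close>, and its degree is too small
  for it to be nonzero. Hence a quotient formed over the larger field already has rational
  coefficients.\<close>

lemma map_poly_of_rat_quotient:
  fixes C :: "'a :: field_char_0 poly"
  assumes "map_poly of_rat p = C * map_poly of_rat q" "q \<noteq> 0"
  shows "\<exists>r. map_poly of_rat r = C"
proof -
  let ?h = "map_poly of_rat :: rat poly \<Rightarrow> 'a poly"
  have hq: "?h q \<noteq> 0"
    using assms(2) map_poly_of_rat_inject[of q 0] by simp
  have "?h p = ?h (p div q) * ?h q + ?h (p mod q)"
    by (simp flip: map_poly_of_rat_mult map_poly_of_rat_add)
  hence eq: "?h (p mod q) = (C - ?h (p div q)) * ?h q"
    by (simp add: assms(1) algebra_simps)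
  have "C - ?h (p div q) = 0"
  proof (rule ccontr)
    assume "C - ?h (p div q) \<noteq> 0"
    hence "Polynomial.degree (?h (p mod q)) \<ge> Polynomial.degree (?h q)" "?h (p mod q) \<noteq> 0"
      using hq by (simp_all add: eq degree_mult_eq)
    moreover have "p mod q \<noteq> 0"
      using \<open>?h (p mod q) \<noteq> 0\<close> by auto
    ultimately show False
      using degree_mod_less'[of q p] assms(2) by (simp add: degree_map_poly)
  qed
  thus ?thesis by auto
qed

text \<open>The product in the description of \<open>cyclotomic\<close>, studied over the complex
  numbers first because its rationality is a consequence of the factorisation of q^n - 1.\<close>

definition complex_cyclotomic :: "nat \<Rightarrow> complex poly"
  where "complex_cyclotomic d = (\<Prod>z\<in>primitive_roots_of_unity d. [:- z, 1:])"

lemma finite_primitive_roots_of_unity: "d > 0 \<Longrightarrow> finite (primitive_roots_of_unity d)"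
  by (rule finite_subset[OF _ finite_roots_unity[of d]]) (auto simp: primitive_roots_of_unity_def)

lemma primitive_roots_of_unity_disjoint:
  assumes "d > 0" "e > 0" "d \<noteq> e"
  shows "primitive_roots_of_unity d \<inter> primitive_roots_of_unity e = {}"
  using assms by (auto simp: primitive_roots_of_unity_def) (metis linorder_neqE_nat)

text \<open>An n-th root of unity lies in the set indexed by its order, and division of n by the
  order leaves remainder zero by minimality.\<close>

lemma Union_primitive_roots_of_unity:
  assumes "n > 0"
  shows "(\<Union>d\<in>{d. d dvd n}. primitive_roots_of_unity d) = {z. z ^ n = 1}"
proof (intro equalityI subsetI)
  fix z assume "z \<in> {z :: complex. z ^ n = 1}"
  hence z: "z ^ n = 1" by simp
  define d where "d = (LEAST k. 0 < k \<and> z ^ k = 1)"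
  have d: "0 < d \<and> z ^ d = 1"
    unfolding d_def by (rule LeastI[of _ n]) (use z assms in auto)
  have least: "z ^ k \<noteq> 1" if "0 < k" "k < d" for k
    using not_less_Least[of k "\<lambda>k. 0 < k \<and> z ^ k = 1"] that by (auto simp: d_def)
  have "z ^ n = z ^ (d * (n div d) + n mod d)" by simp
  also have "\<dots> = z ^ (n mod d)"
    using d by (simp only: power_add power_mult) simp
  finally have "z ^ (n mod d) = 1" using z by simp
  hence "n mod d = 0"
    using least[of "n mod d"] d by (meson mod_less_divisor neq0_conv)
  thus "z \<in> (\<Union>d\<in>{d. d dvd n}. primitive_roots_of_unity d)"
    using d least by (auto simp: primitive_roots_of_unity_def)
qed (auto simp: primitive_roots_of_unity_def power_mult)

text \<open>Two monic polynomials of degree n are equal as soon as they agree at n points; here both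
  vanish at the n roots of unity.\<close>

lemma prod_roots_of_unity:
  assumes "n > 0"
  shows "(\<Prod>z | z ^ n = 1. [:- z, 1:]) = (monom 1 n - 1 :: complex poly)"
proof -
  define P where "P = (\<Prod>z | z ^ n = (1 :: complex). [:- z, 1:])"
  have fin: "finite {z :: complex. z ^ n = 1}"
    using finite_roots_unity[of n] assms by simp
  have degP: "Polynomial.degree P = n"
    using card_roots_unity_eq[OF assms] by (simp add: P_def degree_prod_eq_sum_degree)
  have lcP: "lead_coeff P = 1"
    by (simp add: P_def lead_coeff_prod)
  have degM: "Polynomial.degree (monom 1 n - 1 :: complex poly) = n"
    using assms degree_add_eq_left[of "- 1" "monom 1 n :: complex poly"]
    by (simp add: degree_monom_eq)
  show ?thesis
    unfolding P_def[symmetric]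
  proof (rule poly_eqI_degree_lead_coeff[of _ n])
    show "Polynomial.coeff P n = Polynomial.coeff (monom 1 n - 1) n"
      using lcP degP assms by (simp add: coeff_1)
    show "card {z :: complex. z ^ n = 1} \<ge> n"
      using card_roots_unity_eq[OF assms] by simp
    fix z :: complex assume "z \<in> {z. z ^ n = 1}"
    thus "poly P z = poly (monom 1 n - 1) z"
      using fin by (auto simp: P_def poly_prod poly_monom)
  qed (use degP degM in auto)
qed

lemma prod_complex_cyclotomic:
  assumes "n > 0"
  shows "(\<Prod>d | d dvd n. complex_cyclotomic d) = monom 1 n - 1"
proof -
  have pos: "d > 0" if "d dvd n" for d
    using that assms by (auto intro: Nat.gr0I)
  show ?thesis
    unfolding prod_roots_of_unity[OF assms, symmetric]
      Union_primitive_roots_of_unity[OF assms, symmetric] complex_cyclotomic_def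
    by (rule prod.UNION_disjoint[symmetric])
       (use assms in \<open>auto simp: pos finite_primitive_roots_of_unity
          dest: primitive_roots_of_unity_disjoint[OF pos pos]\<close>)
qed

text \<open>Strong induction: q^d - 1 is the d-th factor times the product over the proper divisors,
  which is rational by induction and nonzero, so the descent of quotients applies.\<close>

lemma complex_cyclotomic_rational:
  assumes "d > 0"
  shows "\<exists>p. map_poly of_rat p = complex_cyclotomic d"
  using assms
proof (induction d rule: less_induct)
  case (less d)
  let ?D = "{e. e dvd d} - {d}"
  have D: "0 < e" "e < d" if "e \<in> ?D" for e
    using that less.prems dvd_imp_le[of e d] by (auto simp: dvd_pos_nat)
  hence "\<forall>e\<in>?D. \<exists>p. map_poly of_rat p = complex_cyclotomic e"
    using less.IH by blast
  then obtain p where p: "\<And>e. e \<in> ?D \<Longrightarrow> map_poly of_rat (p e) = complex_cyclotomic e"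
    by metis
  have "map_poly of_rat (monom 1 d - 1) = (\<Prod>e | e dvd d. complex_cyclotomic e)"
    using less.prems by (simp add: prod_complex_cyclotomic map_poly_of_rat_diff map_poly_monom)
  also have "\<dots> = complex_cyclotomic d * (\<Prod>e\<in>?D. complex_cyclotomic e)"
    using less.prems by (subst prod.remove[of _ d]) auto
  also have "(\<Prod>e\<in>?D. complex_cyclotomic e) = map_poly of_rat (\<Prod>e\<in>?D. p e)"
    by (simp add: map_poly_of_rat_prod p)
  finally have *: "map_poly of_rat (monom 1 d - 1) =
    complex_cyclotomic d * map_poly of_rat (\<Prod>e\<in>?D. p e)" .
  have "complex_cyclotomic e \<noteq> 0" if "e \<in> ?D" for e
    using D(1)[OF that] by (simp add: complex_cyclotomic_def finite_primitive_roots_of_unity)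
  hence "p e \<noteq> 0" if "e \<in> ?D" for e
    using p[OF that] that by (metis map_poly_0)
  hence "(\<Prod>e\<in>?D. p e) \<noteq> 0"
    using less.prems by (subst prod_zero_iff) auto
  from map_poly_of_rat_quotient[OF * this] show ?case .
qed

text \<open>Rationality gives existence for the definite description; injectivity of the coefficient
  embedding gives uniqueness.\<close>

lemma map_poly_of_rat_cyclotomic:
  assumes "d > 0"
  shows "map_poly of_rat (cyclotomic d) = complex_cyclotomic d"
proof -
  obtain p where p: "map_poly of_rat p = complex_cyclotomic d"
    using complex_cyclotomic_rational[OF assms] by blast
  have "cyclotomic d = p"
    unfolding cyclotomic_def complex_cyclotomic_def[symmetric] p[symmetric]
    by (simp add: map_poly_of_rat_inject)
  thus ?thesis using p by simp
qed

lemma prod_cyclotomic: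
  assumes "n > 0"
  shows "(\<Prod>d | d dvd n. cyclotomic d) = monom 1 n - 1"
proof -
  have pos: "d > 0" if "d dvd n" for d
    using that assms by (auto intro: Nat.gr0I)
  have "map_poly of_rat (\<Prod>d | d dvd n. cyclotomic d) = (\<Prod>d | d dvd n. complex_cyclotomic d)"
    by (simp add: map_poly_of_rat_prod map_poly_of_rat_cyclotomic pos)
  also have "\<dots> = map_poly of_rat (monom 1 n - 1)"
    using assms by (simp add: prod_complex_cyclotomic map_poly_of_rat_diff map_poly_monom)
  finally show ?thesis by (simp only: map_poly_of_rat_inject)
qed

lemma cyclotomic_1: "cyclotomic 1 = [:-1, 1:]"
  using prod_cyclotomic[of 1] by (simp add: monom_Suc one_pCons)

lemma cyclotomic_2: "cyclotomic 2 = [:1, 1:]"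
proof -
  have "{d :: nat. d dvd 2} = {1, 2}"
    using prime_nat_iff[of 2] two_is_prime_nat by auto
  hence "[:-1, 1:] * cyclotomic 2 = [:-1, 1:] * [:1, 1:]"
    using prod_cyclotomic[of 2]
    by (simp add: cyclotomic_1[simplified] monom_Suc one_pCons numeral_2_eq_2)
  thus ?thesis by (subst (asm) mult_left_cancel) simp_all
qed

text \<open>The factor of index 1 is q - 1, and cancelling it from q^n - 1 leaves the geometric
  sum.\<close>

lemma prod_cyclotomic_ge_2:
  assumes "n > 0"
  shows "(\<Prod>d | d dvd n \<and> d \<ge> 2. cyclotomic d) = (\<Sum>i<n. monom 1 i)"
proof -
  have "{d. d dvd n \<and> d \<ge> 2} = {d. d dvd n} - {1}"
    using assms by (auto simp: Suc_le_eq numeral_2_eq_2 intro!: Nat.gr0I)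
  hence "[:-1, 1:] * (\<Prod>d | d dvd n \<and> d \<ge> 2. cyclotomic d) = monom 1 n - 1"
    using assms prod_cyclotomic[OF assms] prod.remove[of "{d. d dvd n}" 1 cyclotomic]
    by (simp add: cyclotomic_1[simplified])
  also have "\<dots> = [:-1, 1:] * (\<Sum>i<n. monom 1 i)"
    using power_diff_1_eq[of "monom 1 1 :: rat poly" n]
    by (simp only: monom_power) (simp add: monom_Suc one_pCons)
  finally show ?thesis by (subst (asm) mult_left_cancel) simp_all
qed

text \<open>A non-unit common factor would have a complex root by the fundamental theorem of
  algebra, and this root would have both d and e as its multiplicative order.\<close>

lemma coprime_cyclotomic:
  assumes "d > 0" "e > 0" "d \<noteq> e"
  shows "coprime (cyclotomic d) (cyclotomic e)"
proof (rule coprimeI, rule ccontr)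
  fix g assume g: "g dvd cyclotomic d" "g dvd cyclotomic e" "\<not> is_unit g"
  have root: "z \<in> primitive_roots_of_unity k"
    if k: "k > 0" "g dvd cyclotomic k" and z: "poly (map_poly of_rat g) z = 0" for k z
  proof -
    obtain h where "cyclotomic k = g * h" using k by blast
    hence "poly (map_poly of_rat (cyclotomic k)) z = 0"
      using z by (simp add: map_poly_of_rat_mult)
    thus ?thesis
      using finite_primitive_roots_of_unity[OF k(1)]
      by (auto simp: map_poly_of_rat_cyclotomic[OF k(1)] complex_cyclotomic_def poly_prod)
  qed
  have "map_poly of_rat (cyclotomic d) \<noteq> (0 :: complex poly)"
    using finite_primitive_roots_of_unity[OF assms(1)]
    by (simp add: map_poly_of_rat_cyclotomic[OF assms(1)] complex_cyclotomic_def)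
  hence "g \<noteq> 0" using g by auto
  hence "Polynomial.degree g \<noteq> 0" using g(3) is_unit_iff_degree by blast
  hence "\<not> constant (poly (map_poly of_rat g :: complex poly))"
    by (simp add: constant_degree degree_map_poly)
  then obtain z where "poly (map_poly of_rat g) z = (0 :: complex)"
    using fundamental_theorem_of_algebra by blast
  from root[OF assms(1) g(1) this] root[OF assms(2) g(2) this]
  show False using primitive_roots_of_unity_disjoint[OF assms] by blast
qed


section \<open>Laurent polynomials\<close>

lemma laurent_of_poly_altdef:
  assumes "Polynomial.degree p \<le> n"
  shows "laurent_of_poly p = (\<Sum>i\<le>n. Poly_Mapping.single (int i) (Polynomial.coeff p i))"
  unfolding laurent_of_poly_def using assms
  by (intro sum.mono_neutral_left) (auto simp: coeff_eq_0)

lemma laurent_of_poly_add: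
  "laurent_of_poly (p + q) = laurent_of_poly p + laurent_of_poly q"
proof -
  let ?n = "max (Polynomial.degree p) (Polynomial.degree q)"
  show ?thesis
    by (simp add: laurent_of_poly_altdef[of _ ?n] degree_add_le single_add sum.distrib)
qed

lemma laurent_of_poly_0 [simp]: "laurent_of_poly 0 = 0"
  by (simp add: laurent_of_poly_def)

lemma laurent_of_poly_1 [simp]: "laurent_of_poly 1 = 1"
  by (simp add: laurent_of_poly_def)

lemma laurent_of_poly_smult:
  "laurent_of_poly (Polynomial.smult c p) = Poly_Mapping.single 0 c * laurent_of_poly p"
  by (simp add: laurent_of_poly_altdef[OF degree_smult_le] laurent_of_poly_def[of p]
        sum_distrib_left mult_single)

text \<open>Horner's scheme, which reduces multiplicativity to an induction on the
  coefficients.\<close>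

lemma laurent_of_poly_pCons:
  "laurent_of_poly (pCons a p) = Poly_Mapping.single 0 a + Poly_Mapping.single 1 1 * laurent_of_poly p"
  by (subst laurent_of_poly_altdef[OF degree_pCons_le], subst sum.atMost_Suc_shift)
     (simp add: laurent_of_poly_def[of p] sum_distrib_left mult_single algebra_simps)

lemma laurent_of_poly_mult:
  "laurent_of_poly (p * q) = laurent_of_poly p * laurent_of_poly q"
  by (induction p)
     (simp_all add: laurent_of_poly_add laurent_of_poly_smult laurent_of_poly_pCons algebra_simps)

lemma laurent_of_poly_dvd: "p dvd q \<Longrightarrow> laurent_of_poly p dvd laurent_of_poly q"
  by (elim dvdE) (simp add: laurent_of_poly_mult)

lemma laurent_of_poly_diff: "laurent_of_poly (p - q) = laurent_of_poly p - laurent_of_poly q"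
  using laurent_of_poly_add[of "p - q" q] by (simp add: algebra_simps)

lemma laurent_of_poly_sum: "laurent_of_poly (sum f A) = (\<Sum>x\<in>A. laurent_of_poly (f x))"
  by (induction A rule: infinite_finite_induct) (simp_all add: laurent_of_poly_add)

section \<open>Chinese remainder theorem\<close>

lemma prod_dvd_of_pairwise_coprime:
  fixes P :: "'i \<Rightarrow> 'a :: semiring_gcd"
  assumes "finite D" "\<And>i j. i \<in> D \<Longrightarrow> j \<in> D \<Longrightarrow> i \<noteq> j \<Longrightarrow> coprime (P i) (P j)"
    and "\<And>i. i \<in> D \<Longrightarrow> P i dvd x"
  shows "prod P D dvd x"
  using assms
proof (induction D rule: finite_induct)
  case (insert i D)
  have "coprime (P i) (prod P D)"
    using insert by (intro prod_coprime_right) auto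
  thus ?case using insert by (simp add: divides_mult)
qed simp

text \<open>The \<open>e i\<close> are the idempotents of the Chinese remainder theorem modulo the
  product of all \<open>P i\<close>, each obtained from a Bezout identity. They are described by
  divisibilities alone because ring homomorphisms preserve these.\<close>

lemma chinese_remainder_basis:
  fixes P :: "'i \<Rightarrow> 'a :: euclidean_ring_gcd"
  assumes "finite D" "\<And>i j. i \<in> D \<Longrightarrow> j \<in> D \<Longrightarrow> i \<noteq> j \<Longrightarrow> coprime (P i) (P j)"
  obtains e where "\<And>i. i \<in> D \<Longrightarrow> P i dvd e i - 1" "\<And>i. i \<in> D \<Longrightarrow> prod P (D - {i}) dvd e i"
    "prod P D dvd 1 - sum e D"
proof -
  have "\<exists>e. P i dvd e - 1 \<and> prod P (D - {i}) dvd e" if "i \<in> D" for i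
  proof -
    have "coprime (P i) (prod P (D - {i}))"
      using assms that by (intro prod_coprime_right) auto
    then obtain a b where "a * P i + b * prod P (D - {i}) = 1"
      using bezout_coefficients_fst_snd[of "P i" "prod P (D - {i})"] by (metis coprime_iff_gcd_eq_1)
    hence "b * prod P (D - {i}) - 1 = P i * (- a)" by (simp add: algebra_simps)
    thus ?thesis by (intro exI[of _ "b * prod P (D - {i})"]) simp
  qed
  then obtain e where e: "\<And>i. i \<in> D \<Longrightarrow> P i dvd e i - 1" "\<And>i. i \<in> D \<Longrightarrow> prod P (D - {i}) dvd e i"
    by metis
  \<comment> \<open>Modulo \<open>P i\<close>, every \<open>e j\<close> with j distinct from i
    vanishes and \<open>e i\<close> is 1.\<close>
  have "P i dvd 1 - sum e D" if i: "i \<in> D" for i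
  proof -
    have "P i dvd e j" if "j \<in> D - {i}" for j
      using that i e(2)[of j] assms(1) by (intro dvd_trans[OF dvd_prodI e(2)]) auto
    hence "P i dvd (e i - 1) + sum e (D - {i})"
      using e(1)[OF i] by (intro dvd_add dvd_sum)
    hence "P i dvd - ((e i - 1) + sum e (D - {i}))" by (subst dvd_minus_iff)
    thus ?thesis using assms(1) i by (simp add: sum.remove[of D i] algebra_simps)
  qed
  hence "prod P D dvd 1 - sum e D"
    using assms by (intro prod_dvd_of_pairwise_coprime)
  with e show ?thesis using that by blast
qed

text \<open>For the first claim, x is split into the terms \<open>e i * x\<close> and the rest
  \<open>(1 - sum e D) * x\<close>. In \<open>e i * x\<close> the factor x supplies
  \<open>P i\<close> and \<open>e i\<close> supplies all other \<open>P j\<close>; the rest is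
  divisible by the choice of e.\<close>

lemma laurent_chinese_remainder:
  fixes P :: "'i \<Rightarrow> rat poly"
  assumes "finite D" "\<And>i j. i \<in> D \<Longrightarrow> j \<in> D \<Longrightarrow> i \<noteq> j \<Longrightarrow> coprime (P i) (P j)"
  shows "(\<forall>i\<in>D. laurent_of_poly (P i) dvd x) \<longleftrightarrow> laurent_of_poly (prod P D) dvd x"
    and "\<exists>x. \<forall>i\<in>D. laurent_of_poly (P i) dvd x - y i"
proof -
  let ?L = laurent_of_poly
  obtain e where e: "\<And>i. i \<in> D \<Longrightarrow> P i dvd e i - 1" "\<And>i. i \<in> D \<Longrightarrow> prod P (D - {i}) dvd e i"
    "prod P D dvd 1 - sum e D"
    using chinese_remainder_basis[of D P] assms by blast
  show "(\<forall>i\<in>D. ?L (P i) dvd x) \<longleftrightarrow> ?L (prod P D) dvd x"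
  proof
    assume *: "\<forall>i\<in>D. ?L (P i) dvd x"
    have "?L (prod P D) dvd ?L (e i) * x" if "i \<in> D" for i
    proof -
      have "?L (prod P (D - {i})) * ?L (P i) dvd ?L (e i) * x"
        using that * e(2) by (intro mult_dvd_mono laurent_of_poly_dvd) auto
      thus ?thesis
        using assms(1) that by (simp add: prod.remove[of D i] laurent_of_poly_mult mult.commute)
    qed
    moreover have "?L (prod P D) dvd ?L (1 - sum e D) * x"
      using e(3) by (intro dvd_mult2 laurent_of_poly_dvd)
    ultimately have "?L (prod P D) dvd (\<Sum>i\<in>D. ?L (e i) * x) + ?L (1 - sum e D) * x"
      by (intro dvd_add dvd_sum)
    thus "?L (prod P D) dvd x"
      by (simp add: laurent_of_poly_diff laurent_of_poly_sum algebra_simps flip: sum_distrib_left)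
  next
    assume "?L (prod P D) dvd x"
    thus "\<forall>i\<in>D. ?L (P i) dvd x"
      using assms(1) by (meson dvd_prodI dvd_trans laurent_of_poly_dvd)
  qed
  show "\<exists>x. \<forall>i\<in>D. ?L (P i) dvd x - y i"
  \<comment> \<open>The witness left open by \<open>exI\<close> is the interpolation formula, the
    sum of all \<open>?L (e j) * y j\<close>; it is fixed by the last claim of the block.\<close>
  proof (intro exI ballI)
    fix i assume i: "i \<in> D"
    have "?L (P i) dvd ?L (e j)" if "j \<in> D - {i}" for j
    proof -
      have "P i dvd prod P (D - {j})" using that i assms(1) by (intro dvd_prodI) auto
      thus ?thesis using that e(2)[of j] by (meson DiffD1 dvd_trans laurent_of_poly_dvd)
    qed
    moreover have "?L (P i) dvd ?L (e i - 1)"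
      using e(1)[OF i] by (rule laurent_of_poly_dvd)
    ultimately have "?L (P i) dvd ?L (e i - 1) * y i + (\<Sum>j\<in>D - {i}. ?L (e j) * y j)"
      by (intro dvd_add dvd_sum dvd_mult2)
    thus "?L (P i) dvd (\<Sum>j\<in>D. ?L (e j) * y j) - y i"
      using assms(1) i by (simp add: sum.remove[of D i] laurent_of_poly_diff algebra_simps)
  qed
qed


section \<open>Quotients of cyclic modules\<close>

definition residue_class :: "'a :: comm_ring_1 \<Rightarrow> 'a \<Rightarrow> 'a set"
  where "residue_class p x = {y. p dvd y - x}"

lemma residue_class_eq_iff: "residue_class p x = residue_class p y \<longleftrightarrow> p dvd x - y"
proof
  assume "residue_class p x = residue_class p y"
  moreover have "x \<in> residue_class p x" by (simp add: residue_class_def)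
  ultimately show "p dvd x - y" by (simp add: residue_class_def)
next
  assume *: "p dvd x - y"
  have "p dvd z - x \<longleftrightarrow> p dvd z - y" for z
    using dvd_add_left_iff[OF *, of "z - x"] by simp
  thus "residue_class p x = residue_class p y" by (simp add: residue_class_def)
qed

text \<open>A copy of the ring under \<open>h\<close>, with \<open>N\<close> corresponding to the
  ideal (p). The instances are the regular module with \<open>h = id\<close> and the modules of
  0-cycles and 1-cycles.\<close>

locale cyclic_quotient =
  fixes M :: "('a :: comm_ring_1, 'b) module" and h :: "'a \<Rightarrow> 'b" and p :: 'a and N :: "'b set"
  assumes h_add: "h (x + y) = h x \<oplus>\<^bsub>M\<^esub> h y"
    and h_smult: "h (a * x) = a \<odot>\<^bsub>M\<^esub> h x"
    and h_inj: "inj h"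
    and carrier_eq: "carrier M = range h"
    and N_eq: "N = h ` {y. p dvd y}"
begin

lemma coset_eq: "N +>\<^bsub>M\<^esub> h x = h ` residue_class p x"
proof -
  have "N +>\<^bsub>M\<^esub> h x = (\<lambda>y. h (y + x)) ` {y. p dvd y}"
    by (auto simp: a_r_coset_def' N_eq h_add)
  also have "\<dots> = h ` (\<lambda>y. y + x) ` {y. p dvd y}"
    by (simp add: image_image)
  also have "(\<lambda>y. y + x) ` {y. p dvd y} = residue_class p x"
    by (force simp: residue_class_def image_iff intro: exI[of _ "_ - x"])
  finally show ?thesis .
qed

lemma carrier_quotient: "carrier (quotient_module M N) = range (\<lambda>x. h ` residue_class p x)"
  by (auto simp: quotient_module_def A_RCOSETS_def' carrier_eq coset_eq[symmetric] a_r_coset_def)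

lemma add_quotient:
  "h ` residue_class p x \<oplus>\<^bsub>quotient_module M N\<^esub> h ` residue_class p y = h ` residue_class p (x + y)"
proof -
  have "h ` residue_class p x \<oplus>\<^bsub>quotient_module M N\<^esub> h ` residue_class p y =
      h ` (\<Union>u\<in>residue_class p x. (\<lambda>v. u + v) ` residue_class p y)"
    by (simp add: quotient_module_def set_add_def' image_UN image_image UNION_singleton_eq_range flip: h_add)
  also have "(\<Union>u\<in>residue_class p x. (\<lambda>v. u + v) ` residue_class p y) = residue_class p (x + y)"
  proof (intro equalityI subsetI)
    fix z assume "z \<in> residue_class p (x + y)"
    hence "z - x \<in> residue_class p y" "x \<in> residue_class p x"
      by (simp_all add: residue_class_def algebra_simps)
    thus "z \<in> (\<Union>u\<in>residue_class p x. (\<lambda>v. u + v) ` residue_class p y)"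
      by (auto intro!: bexI[of _ x] image_eqI[of _ _ "z - x"])
  next
    fix z assume "z \<in> (\<Union>u\<in>residue_class p x. (\<lambda>v. u + v) ` residue_class p y)"
    then obtain u v where "p dvd u - x" "p dvd v - y" "z = u + v"
      by (auto simp: residue_class_def)
    thus "z \<in> residue_class p (x + y)"
      using dvd_add[of p "u - x" "v - y"] by (simp add: residue_class_def algebra_simps)
  qed
  finally show ?thesis .
qed

text \<open>In \<open>quotient_module\<close> a scalar acts by the union of the cosets of
  \<open>a * y\<close> over all representatives y. These cosets coincide because p divides
  \<open>a * (y - x)\<close>, and the union is not empty because x represents its own class.\<close>

lemma smult_quotient:
  "a \<odot>\<^bsub>quotient_module M N\<^esub> h ` residue_class p x = h ` residue_class p (a * x)"
proof -
  have "a \<odot>\<^bsub>quotient_module M N\<^esub> h ` residue_class p x = (\<Union>y\<in>residue_class p x. h ` residue_class p (a * y))"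
    by (simp add: quotient_module_def coset_eq flip: h_smult)
  also have "\<dots> = (\<Union>y\<in>residue_class p x. h ` residue_class p (a * x))"
  proof (intro SUP_cong refl arg_cong[of _ _ "(`) h"])
    fix y assume "y \<in> residue_class p x"
    hence "p dvd a * (y - x)" by (simp add: residue_class_def)
    thus "residue_class p (a * y) = residue_class p (a * x)"
      by (simp add: residue_class_eq_iff algebra_simps)
  qed
  also have "\<dots> = h ` residue_class p (a * x)"
  proof -
    have "x \<in> residue_class p x" by (simp add: residue_class_def)
    thus ?thesis by auto
  qed
  finally show ?thesis .
qed

text \<open>First isomorphism theorem: \<open>g\<close> is linear on the ring, onto, and has kernel
  (p), so it factors through the quotient.\<close>

lemma module_iso_quotient:
  fixes P :: "('a, 'c) module"
  assumes "carrier P = range g"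
    and "\<And>x y. g (x + y) = g x \<oplus>\<^bsub>P\<^esub> g y"
    and "\<And>a x. g (a * x) = a \<odot>\<^bsub>P\<^esub> g x"
    and ker: "\<And>x y. g x = g y \<longleftrightarrow> p dvd x - y"
  shows "module_iso R (quotient_module M N) P"
proof -
  \<comment> \<open>A representative is picked by choice; \<open>ker\<close> makes the value
    independent of it.\<close>
  define f where "f C = g (SOME x. h ` residue_class p x = C)" for C
  have eq_iff: "h ` residue_class p x = h ` residue_class p y \<longleftrightarrow> g x = g y" for x y
    by (simp add: inj_image_eq_iff[OF h_inj] residue_class_eq_iff ker)
  have f: "f (h ` residue_class p x) = g x" for x
    unfolding f_def eq_iff by (rule someI) simp
  have "bij_betw f (carrier (quotient_module M N)) (carrier P)"
    unfolding bij_betw_def carrier_quotient assms(1)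
    by (auto simp: inj_on_def f eq_iff image_image)
  thus ?thesis
    unfolding module_iso_def carrier_quotient
    by (intro exI[of _ f]) (auto simp: f add_quotient smult_quotient assms)
qed

end

lemma cyclic_quotient_regular_module:
  "cyclic_quotient (regular_module (ring_of_type_algebra :: 'a :: comm_ring_1 ring)) id p
     (PIdl\<^bsub>ring_of_type_algebra\<^esub> p)"
  by unfold_locales
     (auto simp: regular_module_def ring_of_type_algebra_def cgenideal_def dvd_def mult.commute)

lemma cyclotomic_quotient:
  shows "carrier (cyclotomic_quotient d) = range (residue_class (laurent_of_poly (cyclotomic d)))"
    and "residue_class (laurent_of_poly (cyclotomic d)) x \<oplus>\<^bsub>cyclotomic_quotient d\<^esub>
           residue_class (laurent_of_poly (cyclotomic d)) y =
         residue_class (laurent_of_poly (cyclotomic d)) (x + y)"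
    and "a \<odot>\<^bsub>cyclotomic_quotient d\<^esub> residue_class (laurent_of_poly (cyclotomic d)) x =
         residue_class (laurent_of_poly (cyclotomic d)) (a * x)"
proof -
  interpret cyclic_quotient "regular_module laurent_ring" id "laurent_of_poly (cyclotomic d)"
    "PIdl\<^bsub>laurent_ring\<^esub> (laurent_of_poly (cyclotomic d))"
    by (rule cyclic_quotient_regular_module)
  show "carrier (cyclotomic_quotient d) = range (residue_class (laurent_of_poly (cyclotomic d)))"
    "residue_class (laurent_of_poly (cyclotomic d)) x \<oplus>\<^bsub>cyclotomic_quotient d\<^esub>
       residue_class (laurent_of_poly (cyclotomic d)) y =
     residue_class (laurent_of_poly (cyclotomic d)) (x + y)"
    "a \<odot>\<^bsub>cyclotomic_quotient d\<^esub> residue_class (laurent_of_poly (cyclotomic d)) x =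
     residue_class (laurent_of_poly (cyclotomic d)) (a * x)"
    using carrier_quotient add_quotient smult_quotient by (simp_all add: cyclotomic_quotient_def)
qed


section \<open>Dihedral groups\<close>

lemma equivclp_map:
  fixes f :: "'a \<Rightarrow> 'b"
  assumes "equivclp r x y" "\<And>x y. r x y \<Longrightarrow> equivclp s (f x) (f y)"
  shows "equivclp s (f x) (f y)"
  using assms(1)
proof (induction rule: equivclp_induct)
  case (step y z)
  hence "equivclp s (f y) (f z)"
    using assms(2) equivclp_sym by metis
  with step.IH show ?case by (rule equivclp_trans)
qed simp

text \<open>
  Right multiplication by a generator moves along the Cayley graph, whose universal cover is a line
  with the edges labelled \<open>1\<close> and \<open>2\<close> alternately, the edge from \<open>0\<close> to \<open>1\<close> being labelled \<open>1\<close>.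
\<close>

definition cayley_step :: "int \<Rightarrow> nat \<Rightarrow> int"
  where "cayley_step j s = (if s = 1 \<longleftrightarrow> even j then j + 1 else j - 1)"

definition walk :: "int \<Rightarrow> nat list \<Rightarrow> int"
  where "walk = foldl cayley_step"

lemma walk_Nil [simp]: "walk a [] = a"
  and walk_Cons [simp]: "walk a (s # u) = walk (cayley_step a s) u"
  and walk_append [simp]: "walk a (u @ v) = walk (walk a u) v"
  by (simp_all add: walk_def)

text \<open>The edge labels are invariant under translations by even integers and under reflections
  of j to a - j with a odd; the parity of \<open>a\<close> decides which kind carries 0 to
  \<open>a\<close>.\<close>

lemma walk_reflect: "walk a u = (if even a then a + walk 0 u else a - walk 0 u)"
  by (induction u rule: rev_induct) (auto simp: cayley_step_def)

lemma abs_walk_le: "\<bar>walk 0 u\<bar> \<le> int (length u)"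
  by (induction u rule: rev_induct) (auto simp: cayley_step_def)

text \<open>For k = m the word is the braid-type relator, and its displacement is the origin of the
  period 2m.\<close>

lemma walk_alternating:
  assumes "s \<in> {1, 2}" "t \<in> {1, 2}" "s \<noteq> t"
  shows "walk 0 (concat (replicate k [s, t])) = (if s = 1 then 2 * int k else - 2 * int k)"
  using assms by (induction k) (auto simp: cayley_step_def walk_reflect[of 2] walk_reflect[of "-2"])

text \<open>The labels along the shortest path from 0 to \<open>j\<close>: to the right the path
  starts with the letter 1, to the left with 2. These words serve as normal forms.\<close>

definition alternating_word :: "int \<Rightarrow> nat list"
  where "alternating_word j = map (\<lambda>i. if even i \<longleftrightarrow> j \<ge> 0 then 1 else 2) [0..<nat \<bar>j\<bar>]"

lemma alternating_word_in_lists: "alternating_word j \<in> lists {1, 2}"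
  by (auto simp: alternating_word_def)

lemma length_alternating_word [simp]: "length (alternating_word j) = nat \<bar>j\<bar>"
  by (simp add: alternating_word_def)

lemma alternating_word_0 [simp]: "alternating_word 0 = []"
  by (simp add: alternating_word_def)

lemma alternating_word_snoc_pos:
  "j \<ge> 0 \<Longrightarrow> alternating_word (j + 1) = alternating_word j @ [if even j then 1 else 2]"
  by (simp add: alternating_word_def nat_add_distrib even_nat_iff)

lemma alternating_word_snoc_neg:
  "j \<le> 0 \<Longrightarrow> alternating_word (j - 1) = alternating_word j @ [if even j then 2 else 1]"
proof -
  assume "j \<le> 0"
  hence "nat \<bar>j - 1\<bar> = Suc (nat \<bar>j\<bar>)" by simp
  thus ?thesis using \<open>j \<le> 0\<close>
    by (auto simp: alternating_word_def even_nat_iff)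
qed

lemma walk_alternating_word: "walk 0 (alternating_word j) = j"
proof (induction j rule: int_induct[of _ 0])
  case (step1 i)
  thus ?case by (simp add: alternating_word_snoc_pos cayley_step_def)
next
  case (step2 i)
  thus ?case by (simp add: alternating_word_snoc_neg cayley_step_def)
qed simp

text \<open>As n is even, the two starting points have the same parity, so the word displaces both
  by the same amount.\<close>

lemma dvd_walk_diff:
  assumes "even n" "n dvd a - b"
  shows "n dvd walk a u - walk b u"
proof -
  have "even (a - b)" using assms by (rule dvd_trans)
  thus ?thesis using assms(2) walk_reflect[of a u] walk_reflect[of b u] by auto
qed

section \<open>Word problem of the dihedral group\<close>

context
  fixes m :: nat
  \<comment> \<open>Keeps the letter 1 from turning into \<open>Suc 0\<close> under
    simplification.\<close>
  notes One_nat_def [simp del]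
begin

abbreviation dihedral_equiv :: "nat list \<Rightarrow> nat list \<Rightarrow> bool"
  where "dihedral_equiv \<equiv> equivclp (coxeter_step {1, 2} (I2_matrix m))"

lemma dihedral_equiv_append_right:
  assumes "dihedral_equiv u v" "w \<in> lists {1, 2}"
  shows "dihedral_equiv (u @ w) (v @ w)"
proof (rule equivclp_map[OF assms(1), where f = "\<lambda>u. u @ w"])
  fix x y :: "nat list" assume "coxeter_step {1, 2} (I2_matrix m) x y"
  hence "coxeter_step {1, 2} (I2_matrix m) (x @ w) (y @ w)"
  proof cases
    case (1 u v s t)
    thus ?thesis using coxeter_step.intros[of u "{1,2}" "v @ w" s t] assms(2) by simp
  qed
  thus "dihedral_equiv (x @ w) (y @ w)" by (rule r_into_equivclp)
qed

text \<open>Either the letter prolongs the shortest path, or it repeats the last letter of the word,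
  and the pair is deleted by the relation from the diagonal entry 1 of the matrix.\<close>

lemma alternating_word_snoc:
  assumes "s \<in> {1, 2}"
  shows "dihedral_equiv (alternating_word j @ [s]) (alternating_word (cayley_step j s))"
proof -
  have cancel: "dihedral_equiv (alternating_word i @ [s, s]) (alternating_word i)" for i
    using coxeter_step.intros[of "alternating_word i" "{1, 2}" "[]" s s "I2_matrix m"] assms
      alternating_word_in_lists[of i]
    by (intro r_into_equivclp) (simp add: I2_matrix_def One_nat_def)
  show ?thesis
  proof (cases "s = 1 \<longleftrightarrow> even j")
    case up: True
    show ?thesis
    proof (cases "j \<ge> 0")
      case True
      thus ?thesis using up assms by (auto simp: cayley_step_def alternating_word_snoc_pos)
    next
      case False
      thus ?thesis using up assms cancel[of "j + 1"] alternating_word_snoc_neg[of "j + 1"]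
        by (auto simp: cayley_step_def)
    qed
  next
    case down: False
    show ?thesis
    proof (cases "j \<le> 0")
      case True
      thus ?thesis using down assms by (auto simp: cayley_step_def alternating_word_snoc_neg)
    next
      case False
      thus ?thesis using down assms cancel[of "j - 1"] alternating_word_snoc_pos[of "j - 1"]
        by (auto simp: cayley_step_def)
    qed
  qed
qed

lemma dihedral_equiv_alternating_word:
  assumes "u \<in> lists {1, 2}"
  shows "dihedral_equiv u (alternating_word (walk 0 u))"
  using assms
proof (induction u rule: rev_induct)
  case (snoc s u)
  hence "dihedral_equiv (u @ [s]) (alternating_word (walk 0 u) @ [s])"
    by (intro dihedral_equiv_append_right) auto
  also have "dihedral_equiv \<dots> (alternating_word (walk 0 (u @ [s])))"
    using snoc.prems alternating_word_snoc[of s "walk 0 u"] by simp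
  finally show ?case .
qed simp

text \<open>The relator (1 2)^m put in front translates the rest of the path by 2m. Deleting the
  relator and reducing the whole word to normal form give equivalent words.\<close>

lemma alternating_word_periodic:
  assumes "m > 0"
  shows "dihedral_equiv (alternating_word (2 * int m + j)) (alternating_word j)"
proof -
  let ?w = "concat (replicate m [1, 2]) @ alternating_word j"
  have "coxeter_step {1, 2} (I2_matrix m) ?w (alternating_word j)"
    using coxeter_step.intros[of "[]" "{1, 2}" "alternating_word j" 1 2 "I2_matrix m"] assms
      alternating_word_in_lists[of j]
    by (simp add: I2_matrix_def)
  hence "dihedral_equiv ?w (alternating_word j)" by (rule r_into_equivclp)
  moreover have "walk 0 ?w = 2 * int m + j"
    by (simp add: walk_alternating walk_reflect[of "2 * int m"] walk_alternating_word)
  moreover have "?w \<in> lists {1, 2}"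
    using alternating_word_in_lists[of j] by (auto split: if_splits)
  ultimately show ?thesis
    using dihedral_equiv_alternating_word[of ?w] equivclp_sym equivclp_trans by metis
qed

text \<open>The endpoint mod 2m is an invariant: a relator s s returns to its start, a relator of
  length 2m moves by 2m to one side, and congruent points stay congruent along the remaining
  word.\<close>

lemma coxeter_step_walk:
  assumes "coxeter_step {1, 2} (I2_matrix m) u v"
  shows "2 * int m dvd walk 0 u - walk 0 v"
  using assms
proof cases
  case (1 x y s t)
  show ?thesis
  proof (cases "s = t")
    case True
    thus ?thesis using 1 by (auto simp: I2_matrix_def cayley_step_def One_nat_def)
  next
    case False
    let ?r = "concat (replicate m [s, t])"
    have "2 * int m dvd walk a ?r - a" for a
      using walk_alternating[OF 1(5,6) False, of m]
      by (subst walk_reflect) (auto)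
    thus ?thesis using False 1 dvd_walk_diff[of "2 * int m" "walk (walk 0 x) ?r" "walk 0 x" y]
      by (auto simp: I2_matrix_def)
  qed
qed


lemma dihedral_equiv_walk:
  assumes "dihedral_equiv u v"
  shows "2 * int m dvd walk 0 u - walk 0 v"
  using assms
proof (induction rule: equivclp_induct)
  case (step y z)
  hence "2 * int m dvd walk 0 y - walk 0 z"
    using coxeter_step_walk dvd_diff_commute by metis
  with step.IH have "2 * int m dvd (walk 0 u - walk 0 y) + (walk 0 y - walk 0 z)"
    by (rule dvd_add)
  thus ?case by simp
qed simp

lemma alternating_word_periodic':
  assumes "m > 0"
  shows "dihedral_equiv (alternating_word (2 * int m * k + j)) (alternating_word j)"
proof (induction k rule: int_induct[of _ 0])
  case (step1 i)
  have "dihedral_equiv (alternating_word (2 * int m * (i + 1) + j)) (alternating_word (2 * int m * i + j))"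
    using alternating_word_periodic[OF assms, of "2 * int m * i + j"] by (simp add: algebra_simps)
  thus ?case using step1.IH by (rule equivclp_trans)
next
  case (step2 i)
  have "dihedral_equiv (alternating_word (2 * int m * (i - 1) + j)) (alternating_word (2 * int m * i + j))"
    using alternating_word_periodic[OF assms, of "2 * int m * (i - 1) + j"]
    by (intro equivclp_sym[of _ "alternating_word (2 * int m * i + j)"]) (simp add: algebra_simps)
  thus ?case using step2.IH by (rule equivclp_trans)
qed simp

text \<open>One direction is the invariance of the endpoint; the other passes through the normal
  forms and their periodicity.\<close>

lemma coxeter_rel_I2_iff:
  assumes "m > 0"
  shows "(u, v) \<in> coxeter_rel {1, 2} (I2_matrix m) \<longleftrightarrow>
    u \<in> lists {1, 2} \<and> v \<in> lists {1, 2} \<and> 2 * int m dvd walk 0 u - walk 0 v"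
proof -
  have "dihedral_equiv u v"
    if uv: "u \<in> lists {1, 2}" "v \<in> lists {1, 2}" "2 * int m dvd walk 0 u - walk 0 v"
  proof -
    obtain k where k: "walk 0 u = 2 * int m * k + walk 0 v"
      using uv(3) by (metis dvdE diff_eq_eq)
    have "dihedral_equiv u (alternating_word (2 * int m * k + walk 0 v))"
      using dihedral_equiv_alternating_word[OF uv(1)] by (simp only: k)
    also have "dihedral_equiv \<dots> (alternating_word (walk 0 v))"
      by (rule alternating_word_periodic'[OF assms])
    also have "dihedral_equiv \<dots> v"
      using dihedral_equiv_alternating_word[OF uv(2)] by (rule equivclp_sym)
    finally show ?thesis .
  qed
  thus ?thesis using dihedral_equiv_walk[of u v] by (auto simp: coxeter_rel_def)
qed

text \<open>The group element at vertex \<open>j\<close> of the line. As a set the group becomes the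
  integers mod 2m, but its product is not addition: it is governed by
  \<open>walk_reflect\<close>.\<close>

definition dihedral_class :: "int \<Rightarrow> nat list set"
  where "dihedral_class j = {u \<in> lists {1, 2}. 2 * int m dvd walk 0 u - j}"

lemma coxeter_rel_I2_Image:
  assumes "m > 0" "u \<in> lists {1, 2}"
  shows "coxeter_rel {1, 2} (I2_matrix m) `` {u} = dihedral_class (walk 0 u)"
  using assms by (auto simp: coxeter_rel_I2_iff dihedral_class_def dvd_diff_commute)

lemma dihedral_class_eq_iff: "dihedral_class i = dihedral_class j \<longleftrightarrow> 2 * int m dvd i - j"
proof
  assume "dihedral_class i = dihedral_class j"
  moreover have "alternating_word i \<in> dihedral_class i"
    using alternating_word_in_lists[of i] by (simp add: dihedral_class_def walk_alternating_word)
  ultimately show "2 * int m dvd i - j"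
    by (auto simp: dihedral_class_def walk_alternating_word)
next
  assume *: "2 * int m dvd i - j"
  have "2 * int m dvd a - i \<longleftrightarrow> 2 * int m dvd a - j" for a
    using dvd_add_left_iff[OF *, of "a - i"] by simp
  thus "dihedral_class i = dihedral_class j" by (simp add: dihedral_class_def)
qed

section \<open>Group operations and parabolic subgroups\<close>

lemma coxeter_group_I2_one:
  "m > 0 \<Longrightarrow> \<one>\<^bsub>coxeter_group {1, 2} (I2_matrix m)\<^esub> = dihedral_class 0"
  using coxeter_rel_I2_Image[of "[]"] by (simp add: coxeter_group_def)

lemma coxeter_gen_I2:
  "m > 0 \<Longrightarrow> s \<in> {1, 2} \<Longrightarrow> coxeter_gen {1, 2} (I2_matrix m) s = dihedral_class (walk 0 [s])"
  using coxeter_rel_I2_Image[of "[s]"] by (simp add: coxeter_gen_def)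

lemma coxeter_group_I2_carrier:
  assumes "m > 0"
  shows "carrier (coxeter_group {1, 2} (I2_matrix m)) = (\<lambda>u. dihedral_class (walk 0 u)) ` lists {1, 2}"
  using coxeter_rel_I2_Image[OF assms] by (auto simp: coxeter_group_def quotient_def)

text \<open>The product is formed from all pairs of representatives. Replacing the left one moves
  the start of the second path by a multiple of 2m; replacing the right one changes its displacement
  by such a multiple.\<close>

lemma coxeter_group_I2_mult:
  assumes "m > 0" "u \<in> lists {1, 2}" "v \<in> lists {1, 2}"
  shows "dihedral_class (walk 0 u) \<otimes>\<^bsub>coxeter_group {1, 2} (I2_matrix m)\<^esub> dihedral_class (walk 0 v) =
    dihedral_class (walk 0 (u @ v))"
proof -
  have "dihedral_class (walk 0 (u' @ v')) = dihedral_class (walk 0 (u @ v))"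
    if "u' \<in> dihedral_class (walk 0 u)" "v' \<in> dihedral_class (walk 0 v)" for u' v'
  proof -
    have "2 * int m dvd walk (walk 0 u') v' - walk (walk 0 u) v'"
      using that(1) by (intro dvd_walk_diff) (auto simp: dihedral_class_def)
    moreover have "2 * int m dvd walk (walk 0 u) v' - walk (walk 0 u) v"
      using that(2) by (simp add: walk_reflect[of "walk 0 u"] dihedral_class_def dvd_diff_commute)
    ultimately have "2 * int m dvd walk (walk 0 u') v' - walk (walk 0 u) v"
      using dvd_add[of "2 * int m" "walk (walk 0 u') v' - walk (walk 0 u) v'"] by fastforce
    thus ?thesis by (simp add: dihedral_class_eq_iff)
  qed
  moreover have "w \<in> lists {1, 2}" if "w \<in> dihedral_class j" for w j
    using that by (simp add: dihedral_class_def)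
  ultimately have *: "coxeter_rel {1, 2} (I2_matrix m) `` {u' @ v'} = dihedral_class (walk 0 (u @ v))"
    if "u' \<in> dihedral_class (walk 0 u)" "v' \<in> dihedral_class (walk 0 v)" for u' v'
    using that coxeter_rel_I2_Image[OF assms(1), of "u' @ v'"] by simp
  have "u \<in> dihedral_class (walk 0 u)" "v \<in> dihedral_class (walk 0 v)"
    using assms by (auto simp: dihedral_class_def)
  with * show ?thesis by (simp add: coxeter_group_def) blast
qed

text \<open>\<open>m_inv\<close> is a definite description, so uniqueness is part of the claim. The
  endpoint of \<open>[s]\<close> is 1 or -1, hence odd, so a path \<open>v\<close> after it is
  mirrored; if the result is 0 mod 2m, then \<open>v\<close> ends where \<open>[s]\<close>
  does.\<close>

lemma coxeter_group_I2_inv_gen: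
  assumes "m > 0" "s \<in> {1, 2}"
  shows "inv\<^bsub>coxeter_group {1, 2} (I2_matrix m)\<^esub> dihedral_class (walk 0 [s]) = dihedral_class (walk 0 [s])"
    (is "m_inv ?G ?g = _")
proof -
  have ss: "?g \<otimes>\<^bsub>?G\<^esub> ?g = \<one>\<^bsub>?G\<^esub>"
    using coxeter_group_I2_mult[OF assms(1), of "[s]" "[s]"] assms
    by (auto simp: coxeter_group_I2_one cayley_step_def)
  have "y = ?g" if y: "y \<in> carrier ?G" "?g \<otimes>\<^bsub>?G\<^esub> y = \<one>\<^bsub>?G\<^esub>" for y
  proof -
    obtain v where v: "v \<in> lists {1, 2}" "y = dihedral_class (walk 0 v)"
      using y(1) coxeter_group_I2_carrier[OF assms(1)] by blast
    have "2 * int m dvd walk 0 ([s] @ v)"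
      using y(2) coxeter_group_I2_mult[OF assms(1), of "[s]" v] assms v
      by (simp add: coxeter_group_I2_one dihedral_class_eq_iff)
    moreover have "walk 0 ([s] @ v) = walk 0 [s] - walk 0 v"
      using assms(2) by (simp add: walk_reflect[of "cayley_step 0 s"]) (auto simp: cayley_step_def)
    ultimately have "2 * int m dvd walk 0 v - walk 0 [s]"
      by (simp only: dvd_diff_commute)
    thus ?thesis using v by (simp add: dihedral_class_eq_iff)
  qed
  moreover have "?g \<in> carrier ?G"
    unfolding coxeter_group_I2_carrier[OF assms(1)] using assms(2) by (intro imageI) auto
  ultimately show ?thesis
    unfolding m_inv_def using ss by (intro the_equality) auto
qed

text \<open>The generators are involutions, so inverses contribute nothing beyond words in the
  letters of \<sigma>.\<close>

lemma parabolic_I2: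
  assumes "m > 0" "\<sigma> \<subseteq> {1, 2}"
  shows "parabolic {1, 2} (I2_matrix m) \<sigma> = (\<lambda>u. dihedral_class (walk 0 u)) ` lists \<sigma>"
proof (intro equalityI subsetI)
  let ?G = "coxeter_group {1, 2} (I2_matrix m)"
  have gen: "h \<in> (\<lambda>s. dihedral_class (walk 0 [s])) ` \<sigma>"
    if "h \<in> coxeter_gen {1, 2} (I2_matrix m) ` \<sigma>" for h
    using that coxeter_gen_I2[OF assms(1)] assms(2) by blast
  have gen': "dihedral_class (walk 0 [s]) \<in> (\<lambda>u. dihedral_class (walk 0 u)) ` lists \<sigma>" if "s \<in> \<sigma>" for s
    using that by (intro imageI) auto
  fix x assume "x \<in> parabolic {1, 2} (I2_matrix m) \<sigma>"
  thus "x \<in> (\<lambda>u. dihedral_class (walk 0 u)) ` lists \<sigma>"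
    unfolding parabolic_def
  proof (induction rule: generate.induct)
    case one
    have "[] \<in> lists \<sigma>" by simp
    from imageI[OF this, of "\<lambda>u. dihedral_class (walk 0 u)"] show ?case
      by (simp add: coxeter_group_I2_one assms)
  next
    case (incl h)
    from gen[OF this] gen' show ?case by blast
  next
    case (inv h)
    from gen[OF this] obtain s where "s \<in> \<sigma>" "h = dihedral_class (walk 0 [s])" by blast
    moreover from this have "s \<in> {1, 2}" using assms(2) by blast
    ultimately show ?case
      using gen'[of s] coxeter_group_I2_inv_gen[OF assms(1), of s] by (simp only:)
  next
    case (eng h1 h2)
    then obtain u v where "u \<in> lists \<sigma>" "v \<in> lists \<sigma>"
      "h1 = dihedral_class (walk 0 u)" "h2 = dihedral_class (walk 0 v)" by blast
    moreover from this have "u \<in> lists {1, 2}" "v \<in> lists {1, 2}"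
      using assms(2) by auto
    ultimately have "h1 \<otimes>\<^bsub>?G\<^esub> h2 = dihedral_class (walk 0 (u @ v))" "u @ v \<in> lists \<sigma>"
      using coxeter_group_I2_mult[OF assms(1), of u v] by auto
    thus ?case by blast
  qed
next
  let ?G = "coxeter_group {1, 2} (I2_matrix m)"
  fix x assume "x \<in> (\<lambda>u. dihedral_class (walk 0 u)) ` lists \<sigma>"
  then obtain u where u: "u \<in> lists \<sigma>" "x = dihedral_class (walk 0 u)" by blast
  have "dihedral_class (walk 0 u) \<in> generate ?G (coxeter_gen {1, 2} (I2_matrix m) ` \<sigma>)"
    using u(1)
  proof (induction u rule: rev_induct)
    case Nil
    show ?case using generate.one[of ?G "coxeter_gen {1, 2} (I2_matrix m) ` \<sigma>"]
      by (simp add: coxeter_group_I2_one[OF assms(1)])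
  next
    case (snoc s u)
    hence s: "s \<in> \<sigma>" "u \<in> lists \<sigma>" by auto
    hence "s \<in> {1, 2}" "u \<in> lists {1, 2}" using assms(2) by auto
    moreover from this s have "dihedral_class (walk 0 [s]) \<in> generate ?G (coxeter_gen {1, 2} (I2_matrix m) ` \<sigma>)"
      using coxeter_gen_I2[OF assms(1), of s] by (metis generate.incl imageI)
    ultimately show ?case
      using coxeter_group_I2_mult[OF assms(1), of u "[s]"] snoc.IH[OF s(2)]
        generate.eng[of "dihedral_class (walk 0 u)" ?G] by force
  qed
  thus "x \<in> parabolic {1, 2} (I2_matrix m) \<sigma>" by (simp add: parabolic_def u)
qed

text \<open>The alternating word attains the value. Any word for this element ends at some j + 2mk
  and so has at least |j + 2mk| letters, which is at least |j| because |j| <= m.\<close>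

lemma coxeter_length_dihedral_class:
  assumes "\<bar>j\<bar> \<le> int m"
  shows "coxeter_length (dihedral_class j) = nat \<bar>j\<bar>"
  unfolding coxeter_length_def
proof (rule Least_equality)
  show "\<exists>u\<in>dihedral_class j. length u = nat \<bar>j\<bar>"
    using alternating_word_in_lists[of j]
    by (intro bexI[of _ "alternating_word j"]) (auto simp: dihedral_class_def walk_alternating_word)
next
  fix n assume "\<exists>u\<in>dihedral_class j. length u = n"
  then obtain u where u: "2 * int m dvd walk 0 u - j" "length u = n"
    by (auto simp: dihedral_class_def)
  then obtain k where k: "walk 0 u = j + 2 * int m * k" by (metis dvdE diff_eq_eq add.commute)
  have "\<bar>j\<bar> \<le> \<bar>j + 2 * int m * k\<bar>"
  proof (cases "k = 0")
    case False
    hence "2 * int m \<le> \<bar>2 * int m * k\<bar>"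
      by (simp add: abs_mult) (metis mult_left_mono mult.right_neutral int_one_le_iff_zero_less zero_less_abs_iff of_nat_0_le_iff)
    thus ?thesis using assms by linarith
  qed simp
  thus "nat \<bar>j\<bar> \<le> n" using abs_walk_le[of u] u(2) k by simp
qed

text \<open>The interval is half open because m and -m name the same element, the longest
  one.\<close>

lemma dihedral_class_inj_on: "inj_on dihedral_class {- int m<..int m}"
proof (rule inj_onI)
  fix i j assume *: "i \<in> {- int m<..int m}" "j \<in> {- int m<..int m}"
    and "dihedral_class i = dihedral_class j"
  hence "i \<noteq> j \<Longrightarrow> 2 * int m \<le> \<bar>i - j\<bar>"
    using dvd_imp_le_int[of "i - j" "2 * int m"] by (simp add: dihedral_class_eq_iff)
  moreover have "\<bar>i - j\<bar> < 2 * int m" using * by (simp add: abs_less_iff)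
  ultimately show "i = j" by linarith
qed

section \<open>Poincare polynomials of the parabolic subgroups\<close>

lemma poincare_poly_I2:
  assumes "m > 0" "\<sigma> \<subseteq> {1, 2}" "J \<subseteq> {- int m<..int m}"
    and "dihedral_class ` walk 0 ` lists \<sigma> = dihedral_class ` J"
  shows "finite (parabolic {1, 2} (I2_matrix m) \<sigma>)"
    and "poincare_poly {1, 2} (I2_matrix m) \<sigma> = (\<Sum>j\<in>J. monom 1 (nat \<bar>j\<bar>))"
proof -
  have eq: "parabolic {1, 2} (I2_matrix m) \<sigma> = dihedral_class ` J"
    using assms(4) by (simp add: parabolic_I2[OF assms(1,2)] image_image)
  have "finite J" using assms(3) finite_subset by blast
  thus "finite (parabolic {1, 2} (I2_matrix m) \<sigma>)" by (simp add: eq)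
  have "poincare_poly {1, 2} (I2_matrix m) \<sigma> = (\<Sum>j\<in>J. monom 1 (coxeter_length (dihedral_class j)))"
    unfolding poincare_poly_def eq
    using sum.reindex[OF inj_on_subset[OF dihedral_class_inj_on assms(3)]] by simp
  also have "\<dots> = (\<Sum>j\<in>J. monom 1 (nat \<bar>j\<bar>))"
    using assms(3) by (intro sum.cong refl arg_cong2[of _ _ _ _ monom] coxeter_length_dihedral_class)
       (auto simp: abs_le_iff)
  finally show "poincare_poly {1, 2} (I2_matrix m) \<sigma> = (\<Sum>j\<in>J. monom 1 (nat \<bar>j\<bar>))" .
qed

lemma walk_lists_singleton:
  assumes "s \<in> {1, 2}"
  shows "walk 0 ` lists {s} = {0, walk 0 [s]}"
proof (intro equalityI subsetI)
  fix j assume "j \<in> walk 0 ` lists {s}"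
  then obtain u where "u \<in> lists {s}" "j = walk 0 u" by blast
  moreover have "u \<in> lists {s} \<Longrightarrow> walk 0 u \<in> {0, walk 0 [s]}" for u
    using assms by (induction u rule: rev_induct) (auto simp: cayley_step_def)
  ultimately show "j \<in> {0, walk 0 [s]}" by blast
next
  fix j assume "j \<in> {0, walk 0 [s]}"
  thus "j \<in> walk 0 ` lists {s}"
    using image_eqI[of j "walk 0" "[]" "lists {s}"] image_eqI[of j "walk 0" "[s]" "lists {s}"] by auto
qed

lemma walk_lists_full:
  assumes "m > 0"
  shows "dihedral_class ` walk 0 ` lists {1, 2} = dihedral_class ` {- int m<..int m}"
proof (intro equalityI image_subsetI)
  fix j :: int
  \<comment> \<open>Subtraction from m turns the range 0 <= r < 2m of the remainder into -m < i <=
    m.\<close>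
  define i where "i = int m - (int m - j) mod (2 * int m)"
  have "2 * int m dvd j - i"
    using dvd_minus_mod[of "2 * int m" "int m - j"]
    by (subst dvd_minus_iff[symmetric]) (simp add: i_def algebra_simps)
  moreover have "i \<in> {- int m<..int m}"
    using assms pos_mod_bound[of "2 * int m" "int m - j"] pos_mod_sign[of "2 * int m" "int m - j"]
    by (auto simp: i_def)
  ultimately show "dihedral_class j \<in> dihedral_class ` {- int m<..int m}"
    using dihedral_class_eq_iff by blast
next
  fix j :: int
  show "dihedral_class j \<in> dihedral_class ` walk 0 ` lists {1, 2}"
    using alternating_word_in_lists[of j] walk_alternating_word[of j] by (metis imageI)
qed

lemma poincare_poly_I2_empty:
  assumes "m > 0"
  shows "finite (parabolic {1, 2 :: nat} (I2_matrix m) {})" "poincare_poly {1, 2 :: nat} (I2_matrix m) {} = 1"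
  using poincare_poly_I2[of "{}" "{0}"] assms by auto

text \<open>The bound m >= 2 places -1, the endpoint of the letter 2, in the half-open
  interval.\<close>

lemma poincare_poly_I2_singleton:
  assumes "m \<ge> 2" "s \<in> {1, 2 :: nat}"
  shows "finite (parabolic {1, 2 :: nat} (I2_matrix m) {s})"
    and "poincare_poly {1, 2 :: nat} (I2_matrix m) {s} = [:1, 1:]"
  using poincare_poly_I2[of "{s}" "{0, walk 0 [s]}"] assms
  by (auto simp: walk_lists_singleton cayley_step_def monom_Suc one_pCons)

lemma poincare_poly_I2_full:
  assumes "m > 0"
  shows "finite (parabolic {1, 2 :: nat} (I2_matrix m) {1, 2 :: nat})"
    and "poincare_poly {1, 2 :: nat} (I2_matrix m) {1, 2 :: nat} = [:1, 1:] * (\<Sum>i<m. monom 1 i)"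
proof -
  note * = poincare_poly_I2[OF assms subset_refl subset_refl walk_lists_full[OF assms]]
  show "finite (parabolic {1, 2 :: nat} (I2_matrix m) {1, 2 :: nat})" by (rule *)
  \<comment> \<open>The vertices -i have length i and contribute [m]; the vertices i + 1 contribute
    q [m].\<close>
  have "{- int m<..int m} = (\<lambda>i. - int i) ` {..<m} \<union> (\<lambda>i. int (Suc i)) ` {..<m}"
  proof (intro equalityI subsetI)
    fix j assume "j \<in> {- int m<..int m}"
    thus "j \<in> (\<lambda>i. - int i) ` {..<m} \<union> (\<lambda>i. int (Suc i)) ` {..<m}"
      by (cases "j \<le> 0")
         (auto intro!: image_eqI[of _ "\<lambda>i. - int i" "nat (- j)"]
            image_eqI[of _ "\<lambda>i. int (Suc i)" "nat (j - 1)"] simp del: of_nat_Suc)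
  qed auto
  hence "(\<Sum>j\<in>{- int m<..int m}. monom 1 (nat \<bar>j\<bar>)) =
    (\<Sum>j\<in>(\<lambda>i. - int i) ` {..<m}. monom 1 (nat \<bar>j\<bar>)) + (\<Sum>j\<in>(\<lambda>i. int (Suc i)) ` {..<m}. monom (1 :: rat) (nat \<bar>j\<bar>))"
    by (simp only:) (rule sum.union_disjoint, auto)
  also have "\<dots> = (\<Sum>i<m. monom 1 i) + (\<Sum>i<m. monom 1 (Suc i))"
    by (subst (1 2) sum.reindex) (auto simp: inj_on_def simp del: of_nat_Suc)
  also have "\<dots> = [:1, 1:] * (\<Sum>i<m. monom 1 i)"
    by (simp add: monom_Suc sum_distrib_left sum.distrib)
  finally show "poincare_poly {1, 2 :: nat} (I2_matrix m) {1, 2 :: nat} = [:1, 1:] * (\<Sum>i<m. monom 1 i)"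
    by (simp only: *)
qed

end


section \<open>Homology\<close>

lemma cells_I2:
  assumes "m \<ge> 2"
  shows "cells {1, 2 :: nat} (I2_matrix m) 0 = {{}}"
    and "cells {1, 2 :: nat} (I2_matrix m) 1 = {{1}, {2}}"
    and "cells {1, 2 :: nat} (I2_matrix m) 2 = {{1, 2}}"
proof -
  have fin: "finite (parabolic {1, 2 :: nat} (I2_matrix m) \<sigma>)" if "\<sigma> \<subseteq> {1, 2}" for \<sigma>
  proof -
    from that have "\<sigma> = {} \<or> \<sigma> = {1} \<or> \<sigma> = {2} \<or> \<sigma> = {1, 2}" by blast
    thus ?thesis
      using assms poincare_poly_I2_empty(1)[of m] poincare_poly_I2_singleton(1)[of m 1]
        poincare_poly_I2_singleton(1)[of m 2] poincare_poly_I2_full(1)[of m] by auto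
  qed
  have eq: "cells {1, 2 :: nat} (I2_matrix m) k = {\<sigma> \<in> {{}, {1}, {2}, {1, 2}}. card \<sigma> = k}" for k
    using fin by (auto simp: cells_def)
  show "cells {1, 2 :: nat} (I2_matrix m) 0 = {{}}"
    "cells {1, 2 :: nat} (I2_matrix m) 1 = {{1}, {2}}"
    "cells {1, 2 :: nat} (I2_matrix m) 2 = {{1, 2}}"
    unfolding eq by auto
qed

lemma boundary_coeff_I2:
  assumes "m \<ge> 2"
  shows "s \<in> {1, 2} \<Longrightarrow> boundary_coeff {1, 2 :: nat} (I2_matrix m) {s} {} = laurent_of_poly [:1, 1:]"
    and "boundary_coeff {1, 2 :: nat} (I2_matrix m) {1, 2} {1} = - laurent_of_poly (\<Sum>i<m. monom 1 i)"
    and "boundary_coeff {1, 2 :: nat} (I2_matrix m) {1, 2} {2} = laurent_of_poly (\<Sum>i<m. monom 1 i)"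
proof -
  have q: "poincare_poly {1, 2 :: nat} (I2_matrix m) {1, 2} div [:1, 1:] = (\<Sum>i<m. monom 1 i)"
    using assms by (subst poincare_poly_I2_full, simp, subst nonzero_mult_div_cancel_left) auto
  show "boundary_coeff {1, 2 :: nat} (I2_matrix m) {s} {} = laurent_of_poly [:1, 1:]" if "s \<in> {1, 2}"
  proof -
    have "{t \<in> {s}. \<exists>s'\<in>{s} - {}. t < s'} = {}" by auto
    thus ?thesis
      using assms that by (simp only: boundary_coeff_def incidence_def poincare_poly_I2_singleton)
        (simp add: poincare_poly_I2_empty[simplified])
  qed
  \<comment> \<open>Passing to the facet {1} removes the generator 2, which 1 precedes, whence the
    sign -1; removing 1 gives the sign +1.\<close>
  have "{t \<in> {1, 2 :: nat}. \<exists>s\<in>{1, 2} - {1}. t < s} = {1}" by auto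
  thus "boundary_coeff {1, 2 :: nat} (I2_matrix m) {1, 2} {1} = - laurent_of_poly (\<Sum>i<m. monom 1 i)"
    using assms by (simp only: boundary_coeff_def incidence_def poincare_poly_I2_singleton insert_iff simp_thms q) simp
  have "{t \<in> {1, 2 :: nat}. \<exists>s\<in>{1, 2} - {2}. t < s} = {}" by auto
  thus "boundary_coeff {1, 2 :: nat} (I2_matrix m) {1, 2} {2} = laurent_of_poly (\<Sum>i<m. monom 1 i)"
    using assms by (simp only: boundary_coeff_def incidence_def poincare_poly_I2_singleton insert_iff simp_thms q) simp
qed

theorem mainTheorem3:
  fixes m :: nat
  assumes "m \<ge> 5"
  shows "module_iso laurent_ring
           (salvetti_homology {1, 2 :: nat} (I2_matrix m) 0)
           (cyclotomic_quotient 2) \<and>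
         module_iso laurent_ring
           (salvetti_homology {1, 2 :: nat} (I2_matrix m) 1)
           (direct_sum {d. d dvd m \<and> d \<ge> 2} cyclotomic_quotient)"
proof
  note One_nat_def [simp del]
  let ?S = "{1, 2 :: nat}" and ?M = "I2_matrix m"
  define u where "u = laurent_of_poly [:1, 1:]"
  define v where "v = laurent_of_poly (\<Sum>i<m. monom 1 i)"
  define D where "D = {d. d dvd m \<and> d \<ge> 2}"
  define \<Phi> where "\<Phi> d = laurent_of_poly (cyclotomic d)" for d
  have m: "m \<ge> 2" "m > 0" using assms by auto
  note cells = cells_I2[OF m(1)]
  \<comment> \<open>This allows \<open>u\<close> to be cancelled when the 1-cycles are
    determined.\<close>
  have "u \<noteq> 0"
  proof
    assume "u = 0"
    hence "Poly_Mapping.lookup u 0 = 0" by simp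
    thus False
      by (simp add: u_def laurent_of_poly_pCons lookup_add lookup_single)
  qed
  have \<Phi>_2: "\<Phi> 2 = u" by (simp add: \<Phi>_def cyclotomic_2 u_def)

  have sub0: "{\<sigma> \<in> cells ?S ?M (Suc 0). {} \<subset> \<sigma>} = {{1}, {2}}"
    using cells by (auto simp flip: One_nat_def)
  have boundary_0: "boundary ?S ?M 0 c = (\<lambda>\<tau>\<in>{{}}. (c {1} + c {2}) * u)" for c
    unfolding boundary_def cells(1)
    using m sub0 by (intro restrict_ext) (simp add: boundary_coeff_I2 u_def algebra_simps)
  have sub1: "{\<sigma> \<in> cells ?S ?M 2. \<tau> \<subset> \<sigma>} = {{1, 2}}" if "\<tau> \<in> {{1}, {2}}" for \<tau>
    using cells that by auto
  have boundary_1: "boundary ?S ?M 1 c = (\<lambda>\<tau>\<in>{{1}, {2}}. if \<tau> = {1} then - (c {1, 2} * v) else c {1, 2} * v)" for c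
    unfolding boundary_def cells(2)
    using m by (intro restrict_ext) (auto simp: sub1 boundary_coeff_I2 v_def)

  \<comment> \<open>There are finitely many cells, so the support condition in
    \<open>direct_sum\<close> holds for every function.\<close>
  have chains: "carrier (chains ?S ?M k) = cells ?S ?M k \<rightarrow>\<^sub>E UNIV"
    "\<zero>\<^bsub>chains ?S ?M k\<^esub> = (\<lambda>\<sigma>\<in>cells ?S ?M k. 0)"
    "x \<oplus>\<^bsub>chains ?S ?M k\<^esub> y = (\<lambda>\<sigma>\<in>cells ?S ?M k. x \<sigma> + y \<sigma>)"
    "a \<odot>\<^bsub>chains ?S ?M k\<^esub> x = (\<lambda>\<sigma>\<in>cells ?S ?M k. a * x \<sigma>)" for k x y a
  proof -
    have "finite (cells ?S ?M k)"
      by (rule finite_subset[of _ "Pow ?S"]) (auto simp: cells_def)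
    thus "carrier (chains ?S ?M k) = cells ?S ?M k \<rightarrow>\<^sub>E UNIV"
      "\<zero>\<^bsub>chains ?S ?M k\<^esub> = (\<lambda>\<sigma>\<in>cells ?S ?M k. 0)"
      "x \<oplus>\<^bsub>chains ?S ?M k\<^esub> y = (\<lambda>\<sigma>\<in>cells ?S ?M k. x \<sigma> + y \<sigma>)"
      "a \<odot>\<^bsub>chains ?S ?M k\<^esub> x = (\<lambda>\<sigma>\<in>cells ?S ?M k. a * x \<sigma>)"
      by (auto simp: chains_def direct_sum_def regular_module_def ring_of_type_algebra_def)
  qed

  define h0 :: "laurent \<Rightarrow> nat set \<Rightarrow> laurent" where "h0 x = (\<lambda>\<sigma>\<in>{{}}. x)" for x
  have cycles_0: "cycles ?S ?M 0 = range h0"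
  proof (intro equalityI subsetI)
    fix c assume "c \<in> cycles ?S ?M 0"
    hence "c = h0 (c {})"
      by (auto simp: chains cells h0_def PiE_def extensional_def restrict_def)
    thus "c \<in> range h0" by blast
  qed (auto simp: chains cells h0_def split: if_splits)
  have boundaries_0: "boundaries ?S ?M 0 = h0 ` {y. u dvd y}"
  proof (intro equalityI subsetI)
    fix b assume "b \<in> boundaries ?S ?M 0"
    thus "b \<in> h0 ` {y. u dvd y}" by (auto simp: boundaries_def boundary_0 h0_def)
  next
    fix b assume "b \<in> h0 ` {y. u dvd y}"
    then obtain y where "b = h0 (y * u)" by (metis (no_types, lifting) dvdE imageE mem_Collect_eq mult.commute)
    \<comment> \<open>A single edge realises every multiple of \<open>u\<close>: the whole weight
      \<open>y\<close> is placed on the cell {1}.\<close>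
    hence "b = boundary ?S ?M 0 (\<lambda>\<sigma>\<in>{{1}, {2}}. if \<sigma> = {1} then y else 0)"
      by (simp add: boundary_0 h0_def)
    moreover have "(\<lambda>\<sigma>\<in>{{1}, {2}}. if \<sigma> = {1} then y else 0) \<in> carrier (chains ?S ?M (Suc 0))"
      using cells by (auto simp: chains simp flip: One_nat_def)
    ultimately show "b \<in> boundaries ?S ?M 0" unfolding boundaries_def by blast
  qed
  interpret H0: cyclic_quotient "(chains ?S ?M 0)\<lparr>carrier := cycles ?S ?M 0\<rparr>" h0 u "boundaries ?S ?M 0"
  proof
    show "inj h0" by (auto simp: inj_def h0_def dest: fun_cong[of _ _ "{}"])
  qed (auto simp: cycles_0 boundaries_0 chains cells h0_def simp del: cycles.simps)
  show "module_iso laurent_ring (salvetti_homology ?S ?M 0) (cyclotomic_quotient 2)"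
    unfolding salvetti_homology_def
    \<comment> \<open>The elements of \<open>cyclotomic_quotient 2\<close> are literally the residue
      classes modulo \<open>u\<close>.\<close>
    by (rule H0.module_iso_quotient[where g = "residue_class u"])
       (simp_all add: cyclotomic_quotient[where d = 2, folded \<Phi>_def, unfolded \<Phi>_2] residue_class_eq_iff)

  \<comment> \<open>The signs are those of the boundary of the 2-cell, so a 2-chain with coefficient
    y has boundary \<open>h1 (y * v)\<close>.\<close>
  define h1 :: "laurent \<Rightarrow> nat set \<Rightarrow> laurent"
    where "h1 x = (\<lambda>\<sigma>\<in>{{1}, {2}}. if \<sigma> = {1} then - x else x)" for x
  have cycles_1_iff: "c \<in> cycles ?S ?M 1 \<longleftrightarrow>
      c \<in> {{1}, {2}} \<rightarrow>\<^sub>E UNIV \<and> boundary ?S ?M 0 c = (\<lambda>\<sigma>\<in>{{}}. 0)" for c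
    using cycles.simps(2)[of ?S ?M 0] by (simp only: chains cells flip: One_nat_def) simp
  have cycles_1: "cycles ?S ?M 1 = range h1"
  proof (intro equalityI subsetI)
    fix c assume "c \<in> cycles ?S ?M 1"
    hence c: "c \<in> {{1}, {2}} \<rightarrow>\<^sub>E UNIV" "boundary ?S ?M 0 c = (\<lambda>\<sigma>\<in>{{}}. 0)"
      by (simp_all only: cycles_1_iff)
    from c(2) have "c {1} = - c {2}"
      using \<open>u \<noteq> 0\<close> by (auto simp: boundary_0 add_eq_0_iff2 dest: fun_cong[of _ _ "{}"])
    hence "c = h1 (c {2})"
      using c(1) by (auto simp: h1_def fun_eq_iff restrict_def PiE_def extensional_def)
    thus "c \<in> range h1" by blast
  next
    fix c assume "c \<in> range h1"
    then obtain x where "c = h1 x" by blast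
    thus "c \<in> cycles ?S ?M 1"
      by (auto simp: cycles_1_iff boundary_0 h1_def split: if_splits)
  qed
  have boundaries_1: "boundaries ?S ?M 1 = h1 ` {y. v dvd y}"
  proof (intro equalityI subsetI)
    fix b assume "b \<in> boundaries ?S ?M 1"
    then obtain c where "b = h1 (c {1, 2} * v)"
      by (auto simp: boundaries_def boundary_1 h1_def)
    thus "b \<in> h1 ` {y. v dvd y}" by auto
  next
    fix b assume "b \<in> h1 ` {y. v dvd y}"
    then obtain y where "b = h1 (y * v)" by (metis (no_types, lifting) dvdE imageE mem_Collect_eq mult.commute)
    hence "b = boundary ?S ?M 1 (\<lambda>\<sigma>\<in>{{1, 2}}. y)"
      unfolding boundary_1 h1_def by (simp only: restrict_apply' insertI1)
    moreover have "(\<lambda>\<sigma>\<in>{{1, 2}}. y) \<in> carrier (chains ?S ?M (Suc 1))"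
      using cells by (auto simp: chains)
    ultimately show "b \<in> boundaries ?S ?M 1" unfolding boundaries_def by blast
  qed
  interpret H1: cyclic_quotient "(chains ?S ?M 1)\<lparr>carrier := cycles ?S ?M 1\<rparr>" h1 v "boundaries ?S ?M 1"
  proof
    show "inj h1" by (auto simp: inj_def h1_def dest: fun_cong[of _ _ "{2}"])
  qed (auto simp: cycles_1 boundaries_1 chains cells h1_def simp del: cycles.simps)

  have "finite D" using m by (auto simp: D_def)
  have coprime: "coprime (cyclotomic d) (cyclotomic e)" if "d \<in> D" "e \<in> D" "d \<noteq> e" for d e
    using that by (intro coprime_cyclotomic) (auto simp: D_def)
  have v_eq: "v = laurent_of_poly (prod cyclotomic D)"
    using prod_cyclotomic_ge_2[OF m(2)] by (simp add: v_def D_def)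
  have crt: "(\<forall>d\<in>D. \<Phi> d dvd x) \<longleftrightarrow> v dvd x" "\<exists>z. \<forall>d\<in>D. \<Phi> d dvd z - y d" for x y
    unfolding v_eq \<Phi>_def
    using laurent_chinese_remainder[of D cyclotomic] \<open>finite D\<close> coprime by blast+
  \<comment> \<open>Simultaneous reduction modulo all cyclotomic factors; \<open>crt\<close> yields
    both its surjectivity and its kernel.\<close>
  define g where "g x = (\<lambda>d\<in>D. residue_class (\<Phi> d) x)" for x
  have g_surj: "carrier (direct_sum D cyclotomic_quotient) = range g"
  proof (intro equalityI subsetI)
    fix y assume "y \<in> carrier (direct_sum D cyclotomic_quotient)"
    hence y: "y \<in> extensional D" "\<forall>d\<in>D. \<exists>x. y d = residue_class (\<Phi> d) x"
      by (auto simp: direct_sum_def cyclotomic_quotient \<Phi>_def PiE_def Pi_def)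
    then obtain x where x: "\<And>d. d \<in> D \<Longrightarrow> y d = residue_class (\<Phi> d) (x d)" by metis
    obtain z where z: "\<forall>d\<in>D. \<Phi> d dvd z - x d"
      using crt(2) by blast
    have "g z = y"
      using y(1) z by (intro extensionalityI[of _ D]) (auto simp: g_def x residue_class_eq_iff)
    thus "y \<in> range g" by blast
  next
    fix y assume "y \<in> range g"
    thus "y \<in> carrier (direct_sum D cyclotomic_quotient)"
      using \<open>finite D\<close> by (auto simp: direct_sum_def g_def cyclotomic_quotient \<Phi>_def)
  qed
  have g_ker: "g x = g y \<longleftrightarrow> v dvd x - y" for x y
  proof -
    have "g x = g y \<longleftrightarrow> (\<forall>d\<in>D. \<Phi> d dvd x - y)"
      by (auto simp: g_def fun_eq_iff restrict_def residue_class_eq_iff)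
    thus ?thesis using crt(1) by simp
  qed
  have "module_iso laurent_ring (salvetti_homology ?S ?M 1) (direct_sum D cyclotomic_quotient)"
    unfolding salvetti_homology_def
    by (rule H1.module_iso_quotient[OF g_surj _ _ g_ker])
       (auto simp: g_def direct_sum_def cyclotomic_quotient \<Phi>_def intro!: restrict_ext)
  thus "module_iso laurent_ring (salvetti_homology ?S ?M 1)
    (direct_sum {d. d dvd m \<and> d \<ge> 2} cyclotomic_quotient)"
    by (simp only: D_def)
qed

end
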